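(* There exist sets $S_i\subset\mathbb{N}$ $(i\ge1)$ such that the set $$K=\{0\}\cup\bigcup_{i=1}^\infty 2^{-i}(1+A_{S_i})\subset\mathbb{R}$$ is compact and $$\left\{\dim_H^D K: D\in\mathcal{D}\right\}=\{0,1\}.$$
   Context: $\mathbb{N}$ is the set of positive integers and $|E|$ denotes the diameter of a set $E$. For $S\subset\mathbb{N}$, $A_S=\left\{\sum_{i\in S}x_i2^{-i}: x_i\in\{0,1\}\right\}$. For $X\subset\mathbb{R}$ and $a\in\mathbb{R}$, $aX=\{ax:x\in X\}$ and $a+X=\{a+x:x\in X\}$. $\mathcal{D}$ is the family of all sets $D\subset(0,\infty)$ with $\inf D=0$ that are open in the Sorgenfrey topology (generated by the intervals $[a,b)$), i.e. for every $t\in D$ there is $\delta>0$ with $[t,t+\delta)\subset D$. For $D\in\mathcal{D}$, $E\subset\mathbb{R}^n$ and $s\ge0$ let $$\mathcal{H}^s_{D,\infty}(E)=\inf\left\{\sum_{i=1}^\infty|E_i|^s: E\subset\bigcup_{i=1}^\infty E_i,\ |E_i|\in D\text{ for all }i\right\},\qquad \dim_H^D E=\inf\{s\ge0:\mathcal{H}^s_{D,\infty}(E)=0\}.$$ *)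

theory Defs
  imports "HOL-Analysis.Analysis"
begin

text \<open>The set \<open>S\<close> may be infinite, so the sum is the unordered infinite sum;
  it converges absolutely, being dominated by a geometric series.\<close>

definition binary_digit_set :: "nat set \<Rightarrow> real set" where
  "binary_digit_set S = {(\<Sum>\<^sub>\<infinity>i\<in>S. x i * (1/2) ^ i) |x :: nat \<Rightarrow> real. \<forall>i\<in>S. x i \<in> {0, 1}}"

definition sorgenfrey_topology :: "real topology" where
  "sorgenfrey_topology = topology_generated_by {{a..<b} |a b. True}"

lemma openin_sorgenfrey_topology_iff:
  "openin sorgenfrey_topology D \<longleftrightarrow> (\<forall>t\<in>D. \<exists>\<delta>>0. {t..<t + \<delta>} \<subseteq> D)"
proof
  assume "openin sorgenfrey_topology D"
  then have "generate_topology_on {{a..<b :: real} |a b. True} D"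
    by (simp add: sorgenfrey_topology_def openin_topology_generated_by_iff)
  then show "\<forall>t\<in>D. \<exists>\<delta>>0. {t..<t + \<delta>} \<subseteq> D"
  proof induction
    case Empty
    then show ?case by simp
  next
    case (Int A B)
    show ?case
    proof
      fix t assume "t \<in> A \<inter> B"
      then obtain d e where "d > 0" "{t..<t + d} \<subseteq> A" "e > 0" "{t..<t + e} \<subseteq> B"
        using Int.IH by blast
      then have "min d e > 0 \<and> {t..<t + min d e} \<subseteq> A \<inter> B"
        by (auto simp: subset_iff)
      then show "\<exists>\<delta>>0. {t..<t + \<delta>} \<subseteq> A \<inter> B" by blast
    qed
  next
    case (UN K)
    then show ?case by (meson UnionE Union_upper subset_trans)
  next
    case (Basis I)
    then obtain a b where I: "I = {a..<b}" by blast
    show ?case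
    proof
      fix t assume "t \<in> I"
      then have "b - t > 0 \<and> {t..<t + (b - t)} \<subseteq> I" using I by auto
      then show "\<exists>\<delta>>0. {t..<t + \<delta>} \<subseteq> I" by blast
    qed
  qed
next
  assume *: "\<forall>t\<in>D. \<exists>\<delta>>0. {t..<t + \<delta>} \<subseteq> D"
  have "openin sorgenfrey_topology {a..<b}" for a b
    unfolding sorgenfrey_topology_def by (rule topology_generated_by_Basis) blast
  moreover have "\<exists>T. openin sorgenfrey_topology T \<and> t \<in> T \<and> T \<subseteq> D" if t: "t \<in> D" for t
  proof -
    obtain \<delta> where "\<delta> > 0" "{t..<t + \<delta>} \<subseteq> D" using * t by blast
    then show ?thesis using calculation[of t "t + \<delta>"] by (intro exI[of _ "{t..<t + \<delta>}"]) auto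
  qed
  ultimately show "openin sorgenfrey_topology D"
    by (subst openin_subopen) blast
qed

text \<open>Nonemptiness is explicit because \<open>Inf {}\<close> is an unspecified real,
  whereas \<open>inf D = 0\<close> is meant to exclude the empty set.\<close>

definition admissible_diameters :: "real set set" where
  "admissible_diameters =
     {D. D \<subseteq> {0<..} \<and> D \<noteq> {} \<and> Inf D = 0 \<and> openin sorgenfrey_topology D}"

text \<open>Boundedness is explicit because \<^const>\<open>diameter\<close> is real-valued, with an unspecified
  value on unbounded sets.  All diameters are positive, so at \<open>s = 0\<close> every term is 1.
  The infimum is \<open>\<infinity>\<close> if there is no admissible cover.\<close>

definition hausdorff_content :: "real set \<Rightarrow> real \<Rightarrow> 'a::euclidean_space set \<Rightarrow> ennreal" where
  "hausdorff_content D s E =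
     Inf {(\<Sum>i. ennreal (diameter (F i) powr s)) |F :: nat \<Rightarrow> 'a set.
            E \<subseteq> (\<Union>i. F i) \<and> (\<forall>i. bounded (F i) \<and> diameter (F i) \<in> D)}"

definition hausdorff_dim :: "real set \<Rightarrow> 'a::euclidean_space set \<Rightarrow> ennreal" where
  "hausdorff_dim D E = Inf {ennreal s |s. 0 \<le> s \<and> hausdorff_content D s E = 0}"

end

theory Submission
  imports Defs
begin

text \<open>
  Let \<open>c\<^sub>i(n)\<close> be the number of elements of \<open>S\<^sub>i\<close> up to \<open>n\<close>.  At scale \<open>r\<close> comparable to \<open>(1/2)^n\<close> the
  digit set of \<open>S\<^sub>i\<close> behaves like a set of \<open>2^(c\<^sub>i(n))\<close> points, so for diameters in \<open>D\<close> its dimension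
  is the lower limit of \<open>c\<^sub>i(n) / n\<close> along the \<open>n\<close> with \<open>(1/2)^n\<close> comparable to an element of \<open>D\<close>; and by
  countable stability the dimension of \<open>K\<close> is the supremum of these values over \<open>i\<close>.

  A single \<open>S\<close> cannot produce just the values 0 and 1, because its density varies
  slowly with \<open>n\<close>.  A suitable family can: let \<open>S\<^sub>i\<close> consist of the blocks from \<open>a / i\<close> to \<open>i a\<close>, where \<open>a\<close>
  runs through the even factorials \<open>(2k)!\<close>.  If some \<open>S\<^sub>i\<close> keeps its density above a positive
  constant at certain \<open>n\<close>, then these \<open>n\<close> remain within a bounded factor of the numbers \<open>a\<close>, and
  there the sets \<open>S\<^sub>j\<close> with large \<open>j\<close> have density near 1 (\<open>card_factorial_blocks_amplify\<close>).  So a positive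
  dimension is automatically 1 (\<open>block_union_content_below_1\<close>).  The value 1 arises from scales
  \<open>(1/2)^n\<close> with \<open>n = (2k)!\<close>; the value 0 from \<open>n = (2k+1)!\<close>, which lies deep inside a gap of every \<open>S\<^sub>i\<close>
  (\<open>card_factorial_blocks_between\<close>).

  The upper estimates count digit prefixes (\<open>hausdorff_content_digit_set_eq_0\<close>).  The lower ones
  (\<open>hausdorff_content_digit_set_neq_0\<close>) rest on the fact that the digit sets of \<open>S\<close> and of its complement
  add up to the unit interval, so that the same count for the complement bounds Lebesgue measure.
\<close>

section \<open>Binary digit sums\<close>

lemma has_sum_half_powers_tail:
  "((\<lambda>i. (1/2 :: real) ^ i) has_sum (1/2) ^ n) {n<..}"
proof -
  have "((\<lambda>j. (1/2 :: real) ^ j) has_sum 2) UNIV"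
    using geometric_sums[of "1/2 :: real"] by (intro sums_nonneg_imp_has_sum) auto
  from has_sum_cmult_right[OF this, of "(1/2) ^ Suc n"]
  have "((\<lambda>i. (1/2 :: real) ^ i) \<circ> (\<lambda>j. Suc n + j) has_sum (1/2) ^ n) UNIV"
    by (simp add: o_def power_add)
  moreover have "range (\<lambda>j. Suc n + j) = {n<..}"
    by (auto simp: image_iff) (metis Suc_le_eq le_add_diff_inverse add_Suc)
  ultimately show ?thesis
    by (subst (asm) has_sum_reindex[symmetric]) auto
qed

lemma summable_on_digits:
  fixes x :: "nat \<Rightarrow> real"
  assumes "\<forall>i\<in>S. x i \<in> {0, 1}"
  shows "(\<lambda>i. x i * (1/2) ^ i) summable_on S"
proof (rule summable_on_comparison_test)
  have "(\<lambda>i. (1/2 :: real) ^ i) summable_on UNIV"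
    by (rule norm_summable_imp_summable_on) (simp add: summable_geometric)
  then show "(\<lambda>i. (1/2 :: real) ^ i) summable_on S"
    by (rule summable_on_subset_banach) simp
qed (use assms in auto)

lemma infsum_digits_truncate:
  fixes x :: "nat \<Rightarrow> real"
  assumes S: "S \<subseteq> {1..}" and x: "\<forall>i\<in>S. x i \<in> {0, 1}"
  shows "(\<Sum>\<^sub>\<infinity>i\<in>S. x i * (1/2) ^ i) - (\<Sum>i\<in>S \<inter> {1..n}. x i * (1/2) ^ i) \<in> {0..(1/2) ^ n}"
proof -
  let ?f = "\<lambda>i. x i * (1/2) ^ i"
  have sm: "?f summable_on S" using x by (rule summable_on_digits)
  have smI: "?f summable_on (S \<inter> A)" for A
    using sm by (rule summable_on_subset_banach) simp
  have "infsum ?f ((S \<inter> {1..n}) \<union> (S \<inter> {n<..})) = infsum ?f (S \<inter> {1..n}) + infsum ?f (S \<inter> {n<..})"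
    by (intro infsum_Un_disjoint smI) auto
  moreover have "(S \<inter> {1..n}) \<union> (S \<inter> {n<..}) = S" using S by auto
  moreover have "infsum ?f (S \<inter> {n<..}) \<ge> 0"
    by (rule infsum_nonneg) (use x in auto)
  moreover have "infsum ?f (S \<inter> {n<..}) \<le> infsum (\<lambda>i. (1/2) ^ i) {n<..}"
    using smI has_sum_imp_summable[OF has_sum_half_powers_tail]
    by (rule infsum_mono_neutral) (use x in auto)
  moreover have "infsum (\<lambda>i. (1/2 :: real) ^ i) {n<..} = (1/2) ^ n"
    by (rule infsumI[OF has_sum_half_powers_tail])
  ultimately show ?thesis by simp
qed

text \<open>There is one interval for each choice of the first \<open>n\<close> digits, of which only those at positions
  in \<open>S\<close> are free.  This one count, used for \<open>S\<close> and for its complement, drives both the upper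
  and the lower estimates of contents.\<close>

lemma binary_digit_set_covered:
  assumes S: "S \<subseteq> {1..}"
  obtains P where "finite P" "card P \<le> 2 ^ card (S \<inter> {1..n})"
    "binary_digit_set S \<subseteq> (\<Union>p\<in>P. {p..p + (1/2) ^ n})"
proof
  let ?P = "(\<lambda>T. \<Sum>i\<in>T. (1/2 :: real) ^ i) ` Pow (S \<inter> {1..n})"
  show "finite ?P" by simp
  show "card ?P \<le> 2 ^ card (S \<inter> {1..n})"
    using card_image_le[of "Pow (S \<inter> {1..n})" "\<lambda>T. \<Sum>i\<in>T. (1/2 :: real) ^ i"]
    by (metis card_Pow finite_Int finite_Pow_iff finite_atLeastAtMost)
  show "binary_digit_set S \<subseteq> (\<Union>p\<in>?P. {p..p + (1/2) ^ n})"
  proof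
    fix y assume "y \<in> binary_digit_set S"
    then obtain x :: "nat \<Rightarrow> real" where x: "\<forall>i\<in>S. x i \<in> {0, 1}"
      and y: "y = (\<Sum>\<^sub>\<infinity>i\<in>S. x i * (1/2) ^ i)"
      by (auto simp: binary_digit_set_def)
    let ?T = "{i \<in> S \<inter> {1..n}. x i = 1}"
    have "(\<Sum>i\<in>S \<inter> {1..n}. x i * (1/2) ^ i) = (\<Sum>i\<in>?T. (1/2) ^ i)"
      by (rule sum.mono_neutral_cong_right) (use x in auto)
    with infsum_digits_truncate[OF S x, of n]
    have "y \<in> {(\<Sum>i\<in>?T. (1/2) ^ i)..(\<Sum>i\<in>?T. (1/2) ^ i) + (1/2) ^ n}"
      by (auto simp: y)
    then show "y \<in> (\<Union>p\<in>?P. {p..p + (1/2) ^ n})" by (intro UN_I[OF imageI]) auto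
  qed
qed

text \<open>The binary digits of \<open>y\<close> telescope: the partial sums are the dyadic floors of \<open>y\<close>.
  Sorting the digit positions into \<open>S\<close> and its complement gives the two summands.\<close>

lemma unit_interval_subset_digit_sums:
  assumes S: "S \<subseteq> {1..}" and y: "y \<in> {0..<1 :: real}"
  obtains a b where "a \<in> binary_digit_set S" "b \<in> binary_digit_set ({1..} - S)" "y = a + b"
proof -
  define q where "q i = real_of_int \<lfloor>2 ^ i * y\<rfloor> / 2 ^ i" for i :: nat
  define d where "d i = (if i = 0 then 0 else real_of_int (\<lfloor>2 ^ i * y\<rfloor> - 2 * \<lfloor>2 ^ (i - 1) * y\<rfloor>))" for i :: nat
  have d01: "d i \<in> {0, 1}" for i
  proof (cases i)
    case (Suc j)
    have "\<lfloor>2 * u\<rfloor> - 2 * \<lfloor>u\<rfloor> \<in> {0, 1}" for u :: real by simp linarith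
    from this[of "2 ^ j * y"] have "\<lfloor>2 ^ i * y\<rfloor> - 2 * \<lfloor>2 ^ j * y\<rfloor> \<in> {0, 1}"
      by (simp add: Suc mult.assoc)
    then show ?thesis by (auto simp: d_def Suc)
  qed (simp add: d_def)
  have q0: "q 0 = 0" using y by (simp add: q_def floor_eq_iff)
  have step: "d (Suc i) * (1/2) ^ Suc i = q (Suc i) - q i" for i
    by (simp add: d_def q_def power_one_over field_simps)
  have lower: "(\<lambda>i. y - 1 / 2 ^ i) \<longlonglongrightarrow> y - 0"
    using LIMSEQ_realpow_zero[of "1/2 :: real"] by (intro tendsto_intros) (simp add: power_one_over)
  have "q \<longlonglongrightarrow> y"
  proof (rule real_tendsto_sandwich)
    show "(\<lambda>i. y - 1 / 2 ^ i) \<longlonglongrightarrow> y" using lower by simp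
    show "(\<lambda>i. y) \<longlonglongrightarrow> y" by simp
    show "\<forall>\<^sub>F i in sequentially. y - 1 / 2 ^ i \<le> q i"
    proof (intro always_eventually allI)
      fix i :: nat
      have "2 ^ i * y - 1 \<le> real_of_int \<lfloor>2 ^ i * y\<rfloor>" by linarith
      then have "(2 ^ i * y - 1) / 2 ^ i \<le> q i"
        unfolding q_def by (rule divide_right_mono) simp
      then show "y - 1 / 2 ^ i \<le> q i" by (simp add: diff_divide_distrib)
    qed
    show "\<forall>\<^sub>F i in sequentially. q i \<le> y"
    proof (intro always_eventually allI)
      fix i :: nat
      have "real_of_int \<lfloor>2 ^ i * y\<rfloor> \<le> 2 ^ i * y" by linarith
      then show "q i \<le> y" by (simp add: q_def field_simps)
    qed
  qed
  then have "(\<lambda>i. d (Suc i) * (1/2) ^ Suc i) sums y"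
    using telescope_sums[of q y] by (simp add: step q0 del: power_Suc)
  then have "(\<lambda>i. d i * (1/2) ^ i) sums y"
    by (subst (asm) sums_Suc_iff) (simp add: d_def)
  moreover have nn: "d i * (1/2) ^ i \<ge> 0" for i using d01[of i] by auto
  ultimately have hs: "((\<lambda>i. d i * (1/2) ^ i) has_sum y) UNIV"
    by (rule sums_nonneg_imp_has_sum)
  have "((\<lambda>i. d i * (1/2) ^ i) has_sum y) {1..}"
    using hs by (rule has_sum_cong_neutral[THEN iffD1, rotated -1]) (auto simp: d_def not_less_eq_eq)
  then have "y = (\<Sum>\<^sub>\<infinity>i\<in>S \<union> ({1..} - S). d i * (1/2) ^ i)"
    using S by (simp add: infsumI Un_absorb1)
  also have "\<dots> = (\<Sum>\<^sub>\<infinity>i\<in>S. d i * (1/2) ^ i) + (\<Sum>\<^sub>\<infinity>i\<in>{1..} - S. d i * (1/2) ^ i)"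
    by (rule infsum_Un_disjoint) (use d01 in \<open>auto intro: summable_on_digits\<close>)
  finally show thesis
    using d01 by (intro that) (auto simp: binary_digit_set_def)
qed

text \<open>By Tychonoff's theorem the digit sequences form a compact space, and the sum, a uniform limit
  of its partial sums, depends continuously on the sequence.\<close>

lemma compact_binary_digit_set:
  assumes S: "S \<subseteq> {1..}"
  shows "compact (binary_digit_set S)"
proof -
  let ?X = "PiE UNIV (\<lambda>_ :: nat. {0, 1 :: real})"
  have "compactin (product_topology (\<lambda>_. euclidean) UNIV) ?X"
    by (simp add: compactin_PiE finite_imp_compact)
  then have "compact ?X" by (simp add: euclidean_product_topology)
  moreover have "continuous_on ?X (\<lambda>x. \<Sum>\<^sub>\<infinity>i\<in>S. x i * (1/2) ^ i)"
  proof (rule uniform_limit_theorem)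
    show "\<forall>\<^sub>F n in sequentially. continuous_on ?X (\<lambda>x. \<Sum>i\<in>S \<inter> {1..n}. x i * (1/2) ^ i)"
      by (intro always_eventually allI continuous_intros continuous_on_subset[OF continuous_on_product_coordinates]) auto
    show "uniform_limit ?X (\<lambda>n x. \<Sum>i\<in>S \<inter> {1..n}. x i * (1/2) ^ i)
      (\<lambda>x. \<Sum>\<^sub>\<infinity>i\<in>S. x i * (1/2) ^ i) sequentially"
    proof (rule uniform_limitI)
      fix e :: real assume "e > 0"
      then have "\<forall>\<^sub>F n in sequentially. (1/2 :: real) ^ n < e"
        using LIMSEQ_realpow_zero[of "1/2 :: real"] by (intro order_tendstoD(2)[where y = 0]) auto
      then show "\<forall>\<^sub>F n in sequentially. \<forall>x\<in>?X. dist (\<Sum>i\<in>S \<inter> {1..n}. x i * (1/2) ^ i)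
        (\<Sum>\<^sub>\<infinity>i\<in>S. x i * (1/2) ^ i) < e"
      proof eventually_elim
        case (elim n)
        show ?case
        proof
          fix x assume "x \<in> ?X"
          then have "\<forall>i\<in>S. x i \<in> {0, 1}" by (auto simp: PiE_iff)
          from infsum_digits_truncate[OF S this, of n] elim
          show "dist (\<Sum>i\<in>S \<inter> {1..n}. x i * (1/2) ^ i) (\<Sum>\<^sub>\<infinity>i\<in>S. x i * (1/2) ^ i) < e"
            by (auto simp: dist_real_def)
        qed
      qed
    qed
  qed simp
  ultimately have "compact ((\<lambda>x. \<Sum>\<^sub>\<infinity>i\<in>S. x i * (1/2) ^ i) ` ?X)"
    by (rule compact_continuous_image[rotated])
  moreover have "(\<lambda>x. \<Sum>\<^sub>\<infinity>i\<in>S. x i * (1/2) ^ i) ` ?X = binary_digit_set S"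
  proof (intro equalityI subsetI)
    fix y assume "y \<in> binary_digit_set S"
    then obtain x :: "nat \<Rightarrow> real" where x: "\<forall>i\<in>S. x i \<in> {0, 1}"
      and y: "y = (\<Sum>\<^sub>\<infinity>i\<in>S. x i * (1/2) ^ i)"
      by (auto simp: binary_digit_set_def)
    let ?x = "\<lambda>i. if i \<in> S then x i else 0"
    have "?x \<in> ?X" using x by (simp add: PiE_iff)
    moreover have "y = (\<Sum>\<^sub>\<infinity>i\<in>S. ?x i * (1/2) ^ i)"
      unfolding y by (rule infsum_cong) simp
    ultimately show "y \<in> (\<lambda>x. \<Sum>\<^sub>\<infinity>i\<in>S. x i * (1/2) ^ i) ` ?X"
      by (intro image_eqI[where x = ?x])
  qed (auto simp: binary_digit_set_def PiE_iff)
  ultimately show ?thesis by simp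
qed

section \<open>Hausdorff contents with restricted diameters\<close>

lemma admissible_diameters_small:
  assumes "D \<in> admissible_diameters" "e > 0"
  obtains r where "r \<in> D" "0 < r" "r < e"
proof -
  have D: "D \<subseteq> {0<..}" "D \<noteq> {}" "Inf D < e"
    using assms by (auto simp: admissible_diameters_def)
  from cInf_lessD[OF D(2,3)] obtain r where "r \<in> D" "r < e" by blast
  with D that show thesis by auto
qed

lemma hausdorff_content_mono:
  "E \<subseteq> E' \<Longrightarrow> hausdorff_content D s E \<le> hausdorff_content D s E'"
  unfolding hausdorff_content_def by (rule Inf_superset_mono) blast

lemma hausdorff_content_eq_0I:
  assumes "\<And>e :: real. e > 0 \<Longrightarrow> \<exists>F. E \<subseteq> (\<Union>i. F i) \<and> (\<forall>i. bounded (F i) \<and> diameter (F i) \<in> D) \<and>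
             (\<Sum>i. ennreal (diameter (F i) powr s)) \<le> ennreal e"
  shows "hausdorff_content D s E = 0"
proof -
  have "hausdorff_content D s E \<le> 0 + ennreal e" if "e > 0" for e
    unfolding hausdorff_content_def using assms[OF that] by (auto intro: Inf_lower2)
  then have "hausdorff_content D s E \<le> 0" by (rule ennreal_le_epsilon)
  then show ?thesis by simp
qed

lemma hausdorff_content_eq_0E:
  assumes "hausdorff_content D s E = 0" "e > 0"
  obtains F where "E \<subseteq> (\<Union>i. F i)" "\<And>i :: nat. bounded (F i)" "\<And>i. diameter (F i) \<in> D"
    "(\<Sum>i. ennreal (diameter (F i) powr s)) \<le> ennreal e"
proof -
  have "hausdorff_content D s E < ennreal e" using assms by (simp add: ennreal_less_zero_iff)
  then show thesis
    unfolding hausdorff_content_def Inf_less_iff using that by (auto intro: less_imp_le)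
qed

lemma hausdorff_content_UN_eq_0:
  fixes E :: "nat \<Rightarrow> 'a::euclidean_space set"
  assumes "\<And>i. hausdorff_content D s (E i) = 0"
  shows "hausdorff_content D s (\<Union>i. E i) = 0"
proof (rule hausdorff_content_eq_0I)
  fix e :: real assume e: "e > 0"
  have "\<exists>F. E i \<subseteq> (\<Union>j. F j) \<and> (\<forall>j :: nat. bounded (F j) \<and> diameter (F j) \<in> D) \<and>
      (\<Sum>j. ennreal (diameter (F j) powr s)) \<le> ennreal (e * (1/2) ^ Suc i)" for i
    using hausdorff_content_eq_0E[OF assms[of i], of "e * (1/2) ^ Suc i"] e
    by (metis mult_pos_pos half_gt_zero_iff zero_less_one zero_less_power)
  then obtain F where F: "\<And>i. E i \<subseteq> (\<Union>j. F i j)"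
      "\<And>i j :: nat. bounded (F i j) \<and> diameter (F i j) \<in> D"
      "\<And>i. (\<Sum>j. ennreal (diameter (F i j) powr s)) \<le> ennreal (e * (1/2) ^ Suc i)"
    by metis
  define G where "G k = case_prod F (prod_decode k)" for k
  have "(\<Sum>k. ennreal (diameter (G k) powr s)) = (\<Sum>i j. ennreal (diameter (F i j) powr s))"
    using suminf_ennreal_2dimen[where f = "\<lambda>(i, j). ennreal (diameter (F i j) powr s)"]
    by (simp add: G_def case_prod_beta)
  also have "\<dots> \<le> (\<Sum>i. ennreal (e * (1/2) ^ Suc i))"
    using F(3) by (intro suminf_le summableI)
  also have "\<dots> = ennreal e"
    using e sums_mult[OF power_half_series, of e] by (intro suminf_ennreal_eq) simp_all
  finally have "(\<Sum>k. ennreal (diameter (G k) powr s)) \<le> ennreal e" .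
  moreover have "bounded (G k) \<and> diameter (G k) \<in> D" for k
    using F(2) by (simp add: G_def case_prod_beta)
  moreover have "(\<Union>i. E i) \<subseteq> (\<Union>k. G k)"
  proof
    fix x assume "x \<in> (\<Union>i. E i)"
    then obtain i j where "x \<in> F i j" using F(1) by blast
    then have "x \<in> G (prod_encode (i, j))" by (simp add: G_def)
    then show "x \<in> (\<Union>k. G k)" by blast
  qed
  ultimately show "\<exists>F. (\<Union>i. E i) \<subseteq> (\<Union>i. F i) \<and> (\<forall>i. bounded (F i) \<and> diameter (F i) \<in> D) \<and>
      (\<Sum>i. ennreal (diameter (F i) powr s)) \<le> ennreal e" by blast
qed

text \<open>An admissible cover is an infinite sequence of sets, all of positive diameter.  A finite cover is
  padded with intervals whose lengths are so small that their \<open>s\<close>-th powers form a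
  geometric series; this needs \<open>s > 0\<close> and arbitrarily small elements of \<open>D\<close>.\<close>

lemma hausdorff_content_interval_covers_eq_0:
  fixes E :: "real set"
  assumes D: "D \<in> admissible_diameters" and s: "s > 0"
    and cov: "\<And>e. e > 0 \<Longrightarrow> \<exists>r\<in>D. \<exists>P. finite P \<and> E \<subseteq> (\<Union>p\<in>P. {p..p + r}) \<and> card P * r powr s < e"
  shows "hausdorff_content D s E = 0"
proof (rule hausdorff_content_eq_0I)
  fix e :: real assume e: "e > 0"
  from cov[of "e / 2"] e obtain r P where r: "r \<in> D" and P: "finite P" "E \<subseteq> (\<Union>p\<in>P. {p..p + r})"
    and small: "card P * r powr s < e / 2" by auto
  from P(1) obtain ps where ps: "set ps = P" "distinct ps"
    using finite_distinct_list by blast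
  have r0: "r > 0" using r D by (auto simp: admissible_diameters_def)
  have "\<exists>\<rho>\<in>D. 0 < \<rho> \<and> \<rho> powr s \<le> e / 2 * (1/2) ^ Suc i" for i
  proof -
    let ?u = "e / 2 * (1/2) ^ Suc i"
    have u: "?u > 0" using e by simp
    then have "?u powr (1 / s) > 0" by (simp only: powr_gt_zero)
    with D obtain \<rho> where \<rho>: "\<rho> \<in> D" "0 < \<rho>" "\<rho> < ?u powr (1 / s)"
      by (rule admissible_diameters_small)
    then have "\<rho> powr s \<le> (?u powr (1 / s)) powr s"
      using s by (intro powr_mono2) auto
    also have "\<dots> = ?u" using u s by (simp add: powr_powr)
    finally show ?thesis using \<rho> by blast
  qed
  then obtain \<rho> where \<rho>: "\<And>i. \<rho> i \<in> D" "\<And>i. 0 < \<rho> i"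
      "\<And>i :: nat. \<rho> i powr s \<le> e / 2 * (1/2) ^ Suc i" by metis
  define F where "F i = (if i < length ps then {ps ! i..ps ! i + r} else {0..\<rho> i})" for i
  have diam: "diameter (F i) = (if i < length ps then r else \<rho> i)" for i
    using \<rho>(2)[of i] r0 by (simp add: F_def)
  define g where "g i = (if i \<in> {..<length ps} then r powr s else 0) + e / 2 * (1/2) ^ Suc i" for i
  have "g sums ((\<Sum>i\<in>{..<length ps}. r powr s) + e / 2 * 1)"
    unfolding g_def by (intro sums_add sums_If_finite_set sums_mult power_half_series) simp
  then have "(\<Sum>i. ennreal (g i)) = ennreal (card P * r powr s + e / 2)"
    using e ps(2) unfolding ps(1)[symmetric]
    by (intro suminf_ennreal_eq) (simp_all add: distinct_card, simp add: g_def)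
  moreover have "(\<Sum>i. ennreal (diameter (F i) powr s)) \<le> (\<Sum>i. ennreal (g i))"
    using \<rho>(3) e by (intro suminf_le summableI ennreal_leI) (auto simp: diam g_def)
  moreover have "ennreal (card P * r powr s + e / 2) \<le> ennreal e"
    using small by (intro ennreal_leI) simp
  ultimately have "(\<Sum>i. ennreal (diameter (F i) powr s)) \<le> ennreal e" by simp
  moreover have "bounded (F i) \<and> diameter (F i) \<in> D" for i
    using r \<rho>(1) unfolding diam by (auto simp: F_def)
  moreover have "E \<subseteq> (\<Union>i. F i)"
  proof
    fix x assume "x \<in> E"
    then obtain p where "p \<in> set ps" "x \<in> {p..p + r}" using P(2) ps by blast
    then obtain i where "i < length ps" "x \<in> {ps ! i..ps ! i + r}" by (metis in_set_conv_nth)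
    then have "x \<in> F i" by (simp add: F_def)
    then show "x \<in> (\<Union>i. F i)" by blast
  qed
  ultimately show "\<exists>F. E \<subseteq> (\<Union>i. F i) \<and> (\<forall>i. bounded (F i) \<and> diameter (F i) \<in> D) \<and>
      (\<Sum>i. ennreal (diameter (F i) powr s)) \<le> ennreal e" by blast
qed

section \<open>Contents of digit sets\<close>

lemma hausdorff_content_digit_set_eq_0:
  assumes S: "S \<subseteq> {1..}" and q: "0 < q" "q \<le> 1"
    and D: "D \<in> admissible_diameters" and s: "s > 0"
    and small: "\<And>e. e > 0 \<Longrightarrow> \<exists>r\<in>D. \<exists>n. (1/2) ^ n \<le> r \<and> 2 ^ card (S \<inter> {1..n}) * r powr s < e"
  shows "hausdorff_content D s ((\<lambda>a. q * (1 + a)) ` binary_digit_set S) = 0"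
  using D s
proof (rule hausdorff_content_interval_covers_eq_0)
  fix e :: real assume "e > 0"
  from small[OF this] obtain r n where r: "r \<in> D" "(1/2) ^ n \<le> r"
    and less: "2 ^ card (S \<inter> {1..n}) * r powr s < e" by blast
  obtain P where P: "finite P" "card P \<le> 2 ^ card (S \<inter> {1..n})"
    "binary_digit_set S \<subseteq> (\<Union>p\<in>P. {p..p + (1/2) ^ n})"
    using binary_digit_set_covered[OF S] .
  let ?f = "\<lambda>a. q * (1 + a)"
  have "card (?f ` P) \<le> 2 ^ card (S \<inter> {1..n})"
    using card_image_le[OF P(1), of ?f] P(2) by simp
  then have "real (card (?f ` P)) \<le> 2 ^ card (S \<inter> {1..n})"
    by (metis of_nat_le_iff of_nat_numeral of_nat_power)
  then have "card (?f ` P) * r powr s < e"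
    using less by (meson le_less_trans mult_right_mono powr_ge_zero)
  moreover have "?f ` binary_digit_set S \<subseteq> (\<Union>p\<in>?f ` P. {p..p + r})"
  proof clarify
    fix a assume "a \<in> binary_digit_set S"
    then obtain p where p: "p \<in> P" "p \<le> a" "a \<le> p + (1/2) ^ n" using P(3) by auto
    have "q * (1 + a) - q * (1 + p) = q * (a - p)" by (simp add: algebra_simps)
    also have "\<dots> \<le> 1 * (1/2) ^ n" using p q by (intro mult_mono) auto
    finally have "?f a \<in> {?f p..?f p + r}" using p q r(2) by auto
    then show "?f a \<in> (\<Union>p\<in>?f ` P. {p..p + r})" using p(1) by blast
  qed
  ultimately show "\<exists>r\<in>D. \<exists>P. finite P \<and> ?f ` binary_digit_set S \<subseteq> (\<Union>p\<in>P. {p..p + r}) \<and>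
      card P * r powr s < e"
    using r(1) P(1) by (intro bexI[of _ r] exI[of _ "?f ` P"]) auto
qed

text \<open>The set \<open>G\<close> will be the trace of one member of a cover of the digit set of \<open>S\<close>, and \<open>T\<close> the
  complement of \<open>S\<close>: adding all sums over \<open>T\<close> turns covers of the digit set of \<open>S\<close> into
  covers of the unit interval, to which Lebesgue measure applies.\<close>

lemma sumset_digit_set_measure_le:
  fixes G :: "real set"
  assumes T: "T \<subseteq> {1..}" and w: "w \<ge> 0" and G: "\<And>g g'. g \<in> G \<Longrightarrow> g' \<in> G \<Longrightarrow> dist g g' \<le> w"
  obtains U where "U \<in> sets lborel" "\<And>g b. g \<in> G \<Longrightarrow> b \<in> binary_digit_set T \<Longrightarrow> g + b \<in> U"
    "emeasure lborel U \<le> ennreal (2 ^ card (T \<inter> {1..n}) * (2 * w + (1/2) ^ n))"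
proof (cases "G = {}")
  case True
  then show thesis by (intro that[of "{}"]) auto
next
  case False
  then obtain g0 where g0: "g0 \<in> G" by blast
  obtain P where P: "finite P" "card P \<le> 2 ^ card (T \<inter> {1..n})"
    "binary_digit_set T \<subseteq> (\<Union>p\<in>P. {p..p + (1/2) ^ n})"
    using binary_digit_set_covered[OF T] .
  let ?I = "\<lambda>p. {g0 + p - w..g0 + p + w + (1/2) ^ n}"
  show thesis
  proof (rule that)
    show "(\<Union>p\<in>P. ?I p) \<in> sets lborel" using P(1) by auto
    fix g b assume gb: "g \<in> G" "b \<in> binary_digit_set T"
    then obtain p where p: "p \<in> P" "b \<in> {p..p + (1/2) ^ n}" using P(3) by blast
    have "g + b \<in> ?I p" using G[OF gb(1) g0] p(2) by (auto simp: dist_real_def)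
    then show "g + b \<in> (\<Union>p\<in>P. ?I p)" using p(1) by blast
  next
    have "emeasure lborel (\<Union>p\<in>P. ?I p) \<le> (\<Sum>p\<in>P. emeasure lborel (?I p))"
      using P(1) by (intro emeasure_subadditive_finite) auto
    also have "\<dots> = (\<Sum>p\<in>P. ennreal (2 * w + (1/2) ^ n))"
      using w by (intro sum.cong refl) (simp add: algebra_simps)
    also have "\<dots> = ennreal (card P * (2 * w + (1/2) ^ n))"
      using w by (simp add: ennreal_mult' ennreal_of_nat_eq_real_of_nat)
    also have "\<dots> \<le> ennreal (2 ^ card (T \<inter> {1..n}) * (2 * w + (1/2) ^ n))"
    proof (intro ennreal_leI mult_right_mono)
      show "real (card P) \<le> 2 ^ card (T \<inter> {1..n})"
        using P(2) by (metis of_nat_le_iff of_nat_numeral of_nat_power)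
    qed (use w in auto)
    finally show "emeasure lborel (\<Union>p\<in>P. ?I p) \<le> ennreal (2 ^ card (T \<inter> {1..n}) * (2 * w + (1/2) ^ n))" .
  qed
qed

text \<open>A mass distribution principle with Lebesgue measure in place of a measure on the digit set.
  Let \<open>F k\<close> cover the scaled digit set of \<open>S\<close>.  The digit set of \<open>S\<close> plus that of its complement
  fills the unit interval, so the sumsets of the (rescaled) \<open>F k\<close> with the digit set of
  the complement do too.  At a scale \<open>(1/2)^n\<close> of at least half the diameter of \<open>F k\<close>, the digit set of the
  complement needs only \<open>2^(n - c)\<close> intervals, where \<open>c\<close> counts the elements of \<open>S\<close> up to \<open>n\<close>.
  Hence the sumset has measure at most a constant times \<open>(1/2)^c\<close>, which by hypothesis is at most
  the \<open>t\<close>-th power of the diameter; these powers therefore have a sum bounded below.\<close>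

lemma hausdorff_content_digit_set_neq_0:
  assumes S: "S \<subseteq> {1..}" and q: "0 < q" and t: "t \<ge> 0" and \<rho>: "\<rho> > 0" and D: "D \<subseteq> {0<..}"
    and mass: "\<And>r. r \<in> D \<Longrightarrow> r < \<rho> \<Longrightarrow> \<exists>n. r \<le> 2 * (1/2) ^ n \<and> (1/2) ^ card (S \<inter> {1..n}) \<le> r powr t"
  shows "hausdorff_content D t ((\<lambda>a. q * (1 + a)) ` binary_digit_set S) \<noteq> 0"
proof -
  define C where "C = 4 / q + 1"
  have C: "C > 0" using q by (simp add: C_def add_pos_pos)
  let ?E = "(\<lambda>a. q * (1 + a)) ` binary_digit_set S"
  (* A single set of diameter at least \<rho> already contributes \<rho> powr t; if there is none,
     the measure estimate applies to every set of the cover. *)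
  have "min (ennreal (\<rho> powr t)) (ennreal (1 / C)) \<le> (\<Sum>i. ennreal (diameter (F i) powr t))"
    if cover: "?E \<subseteq> (\<Union>i. F i)" and F: "\<And>i :: nat. bounded (F i)" "\<And>i. diameter (F i) \<in> D" for F
  proof (cases "\<exists>i. \<rho> \<le> diameter (F i)")
    case True
    then obtain i where "\<rho> \<le> diameter (F i)" by blast
    then have "ennreal (\<rho> powr t) \<le> ennreal (diameter (F i) powr t)"
      using \<rho> t by (intro ennreal_leI powr_mono2) auto
    also have "\<dots> \<le> (\<Sum>i. ennreal (diameter (F i) powr t))"
      using ennreal_suminf_lessD by (metis not_less less_irrefl)
    finally show ?thesis by (simp add: min_le_iff_disj)
  next
    case False
    let ?r = "\<lambda>k. diameter (F k)"
    have "\<exists>U. U \<in> sets lborel \<and> (\<forall>a b. q * (1 + a) \<in> F k \<longrightarrow> b \<in> binary_digit_set ({1..} - S) \<longrightarrow> a + b \<in> U)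
        \<and> emeasure lborel U \<le> ennreal C * ennreal (?r k powr t)" for k
    proof -
      from False F(2)[of k] mass[of "?r k"] obtain n where n: "?r k \<le> 2 * (1/2) ^ n"
        "(1/2) ^ card (S \<inter> {1..n}) \<le> ?r k powr t" by (auto simp: not_le)
      have r0: "?r k > 0" using F(2) D by auto
      let ?G = "{a. q * (1 + a) \<in> F k}"
      obtain U where U: "U \<in> sets lborel"
        "\<And>g b. g \<in> ?G \<Longrightarrow> b \<in> binary_digit_set ({1..} - S) \<Longrightarrow> g + b \<in> U"
        "emeasure lborel U \<le> ennreal (2 ^ card (({1..} - S) \<inter> {1..n}) * (2 * (?r k / q) + (1/2) ^ n))"
      proof (rule sumset_digit_set_measure_le[of "{1..} - S" "?r k / q" ?G n])
        fix g g' assume "g \<in> ?G" "g' \<in> ?G"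
        then have "dist (q * (1 + g)) (q * (1 + g')) \<le> ?r k"
          using F(1) by (intro diameter_bounded_bound) auto
        also have "dist (q * (1 + g)) (q * (1 + g')) = q * dist g g'"
          using q by (simp add: dist_real_def flip: right_diff_distrib) (simp add: abs_mult)
        finally show "dist g g' \<le> ?r k / q" using q by (simp add: field_simps)
      qed (use r0 q in auto)
      have "({1..} - S) \<inter> {1..n} = {1..n} - S \<inter> {1..n}" by auto
      then have card: "card (({1..} - S) \<inter> {1..n}) = n - card (S \<inter> {1..n})"
        by (simp add: card_Diff_subset)
      have "card (S \<inter> {1..n}) \<le> n"
        using card_mono[of "{1..n}" "S \<inter> {1..n}"] by simp
      then have "2 ^ card (({1..} - S) \<inter> {1..n}) * (2 * (?r k / q) + (1/2) ^ n)
          = (1/2) ^ card (S \<inter> {1..n}) * (2 ^ n * (2 * (?r k / q) + (1/2) ^ n))"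
        unfolding card by (simp add: power_diff power_one_over)
      also have "\<dots> \<le> ?r k powr t * C"
      proof (intro mult_mono n(2))
        have "2 ^ n * ?r k \<le> 2 ^ n * (2 * (1/2) ^ n)" using n(1) by (intro mult_left_mono) auto
        then have "2 ^ n * ?r k \<le> 2" by (simp add: power_one_over)
        then have "2 ^ n * ?r k * (2 / q) \<le> 2 * (2 / q)" using q by (intro mult_right_mono) auto
        then show "2 ^ n * (2 * (?r k / q) + (1/2) ^ n) \<le> C"
          by (simp add: C_def algebra_simps power_one_over)
      qed (use r0 q in auto)
      finally have "emeasure lborel U \<le> ennreal (?r k powr t * C)"
        using U(3) by (meson ennreal_leI order_trans)
      also have "\<dots> = ennreal C * ennreal (?r k powr t)"
        using C by (simp add: ennreal_mult' mult.commute)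
      finally show ?thesis using U(1,2) by blast
    qed
    then obtain U where U: "\<And>k. U k \<in> sets lborel"
      "\<And>k a b. q * (1 + a) \<in> F k \<Longrightarrow> b \<in> binary_digit_set ({1..} - S) \<Longrightarrow> a + b \<in> U k"
      "\<And>k. emeasure lborel (U k) \<le> ennreal C * ennreal (?r k powr t)" by metis
    have "{0..<1} \<subseteq> (\<Union>k. U k)"
    proof
      fix y :: real assume y: "y \<in> {0..<1}"
      obtain a b where ab: "a \<in> binary_digit_set S" "b \<in> binary_digit_set ({1..} - S)" "y = a + b"
        using unit_interval_subset_digit_sums[OF S y] .
      then obtain k where "q * (1 + a) \<in> F k" using cover by blast
      then show "y \<in> (\<Union>k. U k)" using U(2) ab by blast
    qed
    then have "emeasure lborel {0..<1 :: real} \<le> emeasure lborel (\<Union>k. U k)"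
      using U(1) by (intro emeasure_mono) auto
    also have "\<dots> \<le> (\<Sum>k. emeasure lborel (U k))"
      using U(1) by (intro emeasure_subadditive_countably) auto
    also have "\<dots> \<le> (\<Sum>k. ennreal C * ennreal (?r k powr t))"
      using U(3) by (intro suminf_le summableI)
    finally have "1 \<le> ennreal C * (\<Sum>k. ennreal (?r k powr t))" by simp
    then have "ennreal (1 / C) * 1 \<le> ennreal (1 / C) * (ennreal C * (\<Sum>k. ennreal (?r k powr t)))"
      by (rule mult_left_mono) simp
    also have "\<dots> = (\<Sum>k. ennreal (?r k powr t))"
      using C by (simp add: mult.assoc[symmetric] flip: ennreal_mult')
    finally show ?thesis by (simp add: min_le_iff_disj)
  qed
  then have "min (ennreal (\<rho> powr t)) (ennreal (1 / C)) \<le> hausdorff_content D t ?E"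
    unfolding hausdorff_content_def by (intro Inf_greatest) blast
  moreover have "min (ennreal (\<rho> powr t)) (ennreal (1 / C)) > 0"
    using \<rho> C by (simp add: min_less_iff_conj ennreal_less_zero_iff)
  ultimately have "0 < hausdorff_content D t ?E" by (rule less_le_trans[rotated])
  then show ?thesis by simp
qed

section \<open>Diameters from dyadic intervals\<close>

definition dyadic_scales :: "nat set \<Rightarrow> real set" where
  "dyadic_scales N = (\<Union>n\<in>N. {(1/2) ^ n..<2 * (1/2) ^ n})"

lemma dyadic_scales_admissible:
  assumes "infinite N"
  shows "dyadic_scales N \<in> admissible_diameters"
proof -
  have pos: "dyadic_scales N \<subseteq> {0<..}"
    by (auto simp: dyadic_scales_def intro: less_le_trans[rotated])
  have pow: "(1/2) ^ n \<in> dyadic_scales N" if "n \<in> N" for n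
    using that by (force simp: dyadic_scales_def)
  have "N \<noteq> {}" using assms by auto
  then have ne: "dyadic_scales N \<noteq> {}" using pow by blast
  have bdd: "bdd_below (dyadic_scales N)" using pos by (intro bdd_belowI[of _ 0]) auto
  have "Inf (dyadic_scales N) \<le> 0 + e" if e: "e > 0" for e
  proof -
    obtain m where m: "(1/2 :: real) ^ m < e" using real_arch_pow_inv[OF e, of "1/2"] by auto
    obtain n where n: "n \<in> N" "m \<le> n" using assms unfolding infinite_nat_iff_unbounded_le by blast
    have "Inf (dyadic_scales N) \<le> (1/2) ^ n" by (rule cInf_lower[OF pow[OF n(1)] bdd])
    also have "\<dots> \<le> (1/2) ^ m" using n(2) by (intro power_decreasing) auto
    finally show ?thesis using m by simp
  qed
  then have "Inf (dyadic_scales N) \<le> 0" by (rule field_le_epsilon)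
  moreover have "Inf (dyadic_scales N) \<ge> 0" using ne pos by (intro cInf_greatest) (auto simp: less_imp_le subset_iff)
  moreover have "openin sorgenfrey_topology (dyadic_scales N)"
    unfolding openin_sorgenfrey_topology_iff
  proof
    fix t assume "t \<in> dyadic_scales N"
    then obtain n where n: "n \<in> N" "t \<in> {(1/2) ^ n..<2 * (1/2) ^ n}" by (auto simp: dyadic_scales_def)
    then have "{t..<t + (2 * (1/2) ^ n - t)} \<subseteq> {(1/2) ^ n..<2 * (1/2) ^ n}" by auto
    also have "\<dots> \<subseteq> dyadic_scales N" using n(1) by (auto simp: dyadic_scales_def)
    finally show "\<exists>\<delta>>0. {t..<t + \<delta>} \<subseteq> dyadic_scales N"
      using n(2) by (intro exI[of _ "2 * (1/2) ^ n - t"]) simp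
  qed
  ultimately show ?thesis using pos ne by (simp add: admissible_diameters_def)
qed

lemma half_power_eq_powr: "(1/2 :: real) ^ n = 2 powr (- real n)"
  by (simp add: powr_minus powr_realpow power_one_over inverse_eq_divide)

lemma obtain_dyadic_scale:
  fixes r :: real
  assumes "0 < r" "r < 1"
  obtains n where "n \<ge> 1" "(1/2) ^ n \<le> r" "r < 2 * (1/2) ^ n"
proof -
  have ex: "\<exists>n. (1/2) ^ n \<le> r" using real_arch_pow_inv[of r "1/2"] assms by (auto intro: less_imp_le)
  define n where "n = (LEAST n. (1/2) ^ n \<le> r)"
  have n: "(1/2) ^ n \<le> r" unfolding n_def using ex by (rule LeastI_ex)
  then have "n \<noteq> 0" using assms by (metis not_less power_0)
  then obtain m where m: "n = Suc m" using not0_implies_Suc by blast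
  have "\<not> (1/2) ^ m \<le> r" using not_less_Least[of m "\<lambda>n. (1/2) ^ n \<le> r"] by (simp add: m flip: n_def)
  then show thesis using that[of n] n m by simp
qed

section \<open>Digit positions in blocks around even factorials\<close>

text \<open>In real terms, \<open>S\<^sub>i\<close> is the union of the blocks from \<open>a / i\<close> to \<open>i a\<close>, for \<open>a = (2k)!\<close>.
  The odd factorials mark the middle of the gaps: \<open>(2k+1)!\<close> is far from both \<open>(2k)!\<close> and \<open>(2k+2)!\<close>,
  by factors that tend to infinity with \<open>k\<close>.\<close>

definition factorial_blocks :: "nat \<Rightarrow> nat set" where
  "factorial_blocks i = {m. \<exists>k. fact (2 * k) < i * m \<and> m \<le> i * fact (2 * k)}"

lemma factorial_blocks_subset: "factorial_blocks i \<subseteq> {1..}"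
  by (auto simp: factorial_blocks_def Suc_le_eq intro!: gr0I)

lemma card_le_if_bounded:
  fixes A :: "nat set"
  assumes "A \<subseteq> {1..b}" shows "card A \<le> b"
  using card_mono[OF _ assms] by simp

lemma card_factorial_blocks_ge:
  assumes "n \<le> j * fact (2 * k)"
  shows "real n - fact (2 * k) / j \<le> card (factorial_blocks j \<inter> {1..n})"
proof (cases "j = 0")
  case False
  let ?a = "fact (2 * k) :: nat"
  have "{?a div j + 1..n} \<subseteq> factorial_blocks j \<inter> {1..n}"
  proof
    fix m assume m: "m \<in> {?a div j + 1..n}"
    then have "?a div j < m" by auto
    then have "?a < j * m" using False by (simp add: div_less_iff_less_mult mult.commute)
    then show "m \<in> factorial_blocks j \<inter> {1..n}" using m assms by (auto simp: factorial_blocks_def)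
  qed
  then have "n - ?a div j \<le> card (factorial_blocks j \<inter> {1..n})"
    using card_mono[of "factorial_blocks j \<inter> {1..n}" "{?a div j + 1..n}"] by simp
  moreover have "real (?a div j) \<le> real ?a / j" by (rule of_nat_div_le_of_nat)
  ultimately show ?thesis by simp
qed (use assms in simp)

text \<open>At \<open>n = (2k+1)!\<close> the next block has not begun, so at most \<open>i (2k)!\<close>, a fraction
  \<open>i / (2k+1)\<close> of the first \<open>n\<close> positions, is occupied.\<close>

lemma card_factorial_blocks_between:
  assumes "i \<le> 2 * k + 2"
  shows "card (factorial_blocks i \<inter> {1..fact (2 * k + 1)}) \<le> i * fact (2 * k)"
proof (rule card_le_if_bounded, clarify)
  fix m assume m: "m \<in> factorial_blocks i" "m \<in> {1..fact (2 * k + 1)}"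
  then obtain l where l: "fact (2 * l) < i * m" "m \<le> i * fact (2 * l)" by (auto simp: factorial_blocks_def)
  note l(1)
  also have "i * m \<le> (2 * k + 2) * fact (2 * k + 1)" using assms m(2) by (intro mult_mono) auto
  also have "\<dots> = fact (2 * (k + 1))" by simp
  finally have less: "(fact (2 * l) :: nat) < fact (2 * (k + 1))" .
  have "\<not> k + 1 \<le> l"
  proof
    assume "k + 1 \<le> l"
    then have "(fact (2 * (k + 1)) :: nat) \<le> fact (2 * l)" by (intro fact_mono_nat) simp
    with less show False by simp
  qed
  then have "(fact (2 * l) :: nat) \<le> fact (2 * k)" by (intro fact_mono_nat) simp
  then have "i * fact (2 * l) \<le> i * (fact (2 * k) :: nat)" by simp
  with l(2) have "m \<le> i * fact (2 * k)" by (rule order_trans)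
  then show "m \<in> {1..i * fact (2 * k)}" using m(2) by simp
qed

text \<open>The reason why no intermediate dimension occurs: if \<open>S\<^sub>i\<close> has density at least \<open>c\<close> up to \<open>n\<close>,
  then \<open>n\<close> is at most a bounded multiple of some \<open>a = (2k)!\<close> whose \<open>S\<^sub>i\<close>-block starts before \<open>n\<close>.  The wider
  block of \<open>S\<^sub>j\<close> around the same \<open>a\<close> starts much earlier, at \<open>a / j < i n / j\<close>, and still
  contains \<open>n\<close>; so for large \<open>j\<close> the density of \<open>S\<^sub>j\<close> up to \<open>n\<close> is close to 1.\<close>

lemma card_factorial_blocks_amplify:
  fixes c :: real
  assumes n: "n \<ge> 1" and c: "c > 0" "c * n \<le> card (factorial_blocks i \<inter> {1..n})" and j: "j \<ge> 1" "i / c \<le> j"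
  shows "(1 - i / j) * n \<le> card (factorial_blocks j \<inter> {1..n})"
proof -
  let ?A = "factorial_blocks i \<inter> {1..n}"
  have "card ?A > 0" using n c by (metis mult_pos_pos of_nat_0_less_iff less_le_trans zero_less_one)
  then have ne: "?A \<noteq> {}" by force
  define m where "m = Max ?A"
  have "m \<in> ?A" unfolding m_def using ne by (intro Max_in) auto
  then obtain k where m: "m \<le> n" "fact (2 * k) < i * m" "m \<le> i * fact (2 * k)"
    by (auto simp: factorial_blocks_def)
  have "?A \<subseteq> {1..m}" by (auto simp: m_def)
  then have "card ?A \<le> m" by (rule card_le_if_bounded)
  then have "c * n \<le> real (i * fact (2 * k))" using c m(3) by linarith
  then have "n \<le> i / c * fact (2 * k)" using c(1) by (simp add: field_simps)
  also have "\<dots> \<le> real j * fact (2 * k)" using j by (intro mult_right_mono) auto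
  finally have "real n \<le> real (j * fact (2 * k))" by simp
  then have "n \<le> j * fact (2 * k)" by (simp only: of_nat_le_iff)
  from card_factorial_blocks_ge[OF this]
  have "real n - fact (2 * k) / j \<le> card (factorial_blocks j \<inter> {1..n})" .
  moreover have "(fact (2 * k) :: real) \<le> i * n"
  proof -
    have "fact (2 * k) \<le> i * n" using m(1,2) by (meson le_trans less_imp_le mult_le_mono2)
    then have "real (fact (2 * k)) \<le> real (i * n)" by (simp only: of_nat_le_iff)
    then show ?thesis by simp
  qed
  then have "fact (2 * k) / real j \<le> i * n / j" by (rule divide_right_mono) simp
  ultimately show ?thesis by (simp add: algebra_simps)
qed

section \<open>The compact union of the scaled digit sets\<close>

definition block_set :: "nat \<Rightarrow> real set" where
  "block_set i = (\<lambda>a. (1/2) ^ i * (1 + a)) ` binary_digit_set (factorial_blocks i)"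

definition block_union :: "real set" where
  "block_union = {0} \<union> (\<Union>i\<in>{1..}. block_set i)"

lemma block_set_bounds:
  assumes "x \<in> block_set i"
  shows "(1/2) ^ i \<le> x" "x \<le> 2 * (1/2) ^ i"
proof -
  obtain y where y: "y \<in> binary_digit_set (factorial_blocks i)" and x: "x = (1/2) ^ i * (1 + y)"
    using assms by (auto simp: block_set_def)
  from y obtain d :: "nat \<Rightarrow> real" where d: "\<forall>k\<in>factorial_blocks i. d k \<in> {0, 1}"
    and yd: "y = (\<Sum>\<^sub>\<infinity>k\<in>factorial_blocks i. d k * (1/2) ^ k)" by (auto simp: binary_digit_set_def)
  have "0 \<le> y" "y \<le> 1"
    using infsum_digits_truncate[OF factorial_blocks_subset d, of 0] yd by auto
  then have "(1/2) ^ i * 1 \<le> (1/2) ^ i * (1 + y)" "(1/2) ^ i * (1 + y) \<le> (1/2) ^ i * 2"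
    by (intro mult_left_mono; simp)+
  then show "(1/2) ^ i \<le> x" "x \<le> 2 * (1/2) ^ i" by (simp_all add: x)
qed

lemma compact_block_set: "compact (block_set i)"
  unfolding block_set_def
  by (intro compact_continuous_image continuous_intros compact_binary_digit_set factorial_blocks_subset)

lemma compact_block_union: "compact block_union"
proof -
  (* Finitely many pieces lie away from 0, and the remaining ones fit into a short interval at 0. *)
  let ?K = "\<lambda>n. {0..2 * (1/2) ^ n} \<union> (\<Union>i\<in>{1..n}. block_set i)"
  have "block_union = (\<Inter>n. ?K n)"
  proof (intro equalityI subsetI)
    fix x assume x: "x \<in> block_union"
    show "x \<in> (\<Inter>n. ?K n)"
    proof
      fix n
      show "x \<in> ?K n"
      proof (cases "x = 0")
        case False
        then obtain i where i: "i \<ge> 1" "x \<in> block_set i" using x by (auto simp: block_union_def)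
        show ?thesis
        proof (cases "i \<le> n")
          case False
          have "(1/2 :: real) ^ i \<le> (1/2) ^ n" using False by (intro power_decreasing) auto
          then have "x \<le> 2 * (1/2) ^ n" using block_set_bounds(2)[OF i(2)] by linarith
          moreover have "0 \<le> x"
            using block_set_bounds(1)[OF i(2)] by (rule order_trans[rotated]) simp
          ultimately show ?thesis by simp
        qed (use i in auto)
      qed simp
    qed
  next
    fix x assume x: "x \<in> (\<Inter>n. ?K n)"
    show "x \<in> block_union"
    proof (cases "x = 0")
      case False
      have "(1/2 :: real) ^ i \<ge> 0" for i by simp
      then have "x \<ge> 0" using x block_set_bounds(1) by (force dest: InterD intro: order_trans)
      with False obtain n where n: "(1/2 :: real) ^ n < x / 2"
        using real_arch_pow_inv[of "x / 2" "1/2"] by auto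
      have "x \<in> ?K n" using x by blast
      then show ?thesis using n by (auto simp: block_union_def)
    qed (simp add: block_union_def)
  qed
  moreover have "compact (\<Inter>n. ?K n)"
    by (intro compact_Inter) (auto intro!: compact_Un compact_UN compact_block_set)
  ultimately show ?thesis by simp
qed

section \<open>Contents and dimensions of the union\<close>

lemma block_union_content_eq_0:
  assumes D: "D \<in> admissible_diameters" and s: "s > 0"
    and small: "\<And>i e. i \<ge> 1 \<Longrightarrow> e > 0 \<Longrightarrow>
      \<exists>r\<in>D. \<exists>n. (1/2) ^ n \<le> r \<and> 2 ^ card (factorial_blocks i \<inter> {1..n}) * r powr s < e"
  shows "hausdorff_content D s block_union = 0"
proof -
  have "hausdorff_content D s {0 :: real} = 0"
    using D s
  proof (rule hausdorff_content_interval_covers_eq_0)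
    fix e :: real assume e: "e > 0"
    then have "e powr (1 / s) > 0" by simp
    with D obtain r where r: "r \<in> D" "0 < r" "r < e powr (1 / s)" by (rule admissible_diameters_small)
    then have "r powr s < (e powr (1 / s)) powr s" using s by (intro powr_less_mono2) auto
    also have "\<dots> = e" using s e by (simp add: powr_powr)
    finally show "\<exists>r\<in>D. \<exists>P. finite P \<and> {0} \<subseteq> (\<Union>p\<in>P. {p..p + r}) \<and> card P * r powr s < e"
      using r by (intro bexI[of _ r] exI[of _ "{0}"]) auto
  qed
  moreover have "hausdorff_content D s (block_set (Suc i)) = 0" for i
    unfolding block_set_def
  proof (rule hausdorff_content_digit_set_eq_0[OF factorial_blocks_subset _ _ D s])
    show "(1/2 :: real) ^ Suc i \<le> 1" by (rule power_le_one) auto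
  qed (use small[of "Suc i"] in simp_all)
  ultimately have "hausdorff_content D s (\<Union>i. case i of 0 \<Rightarrow> {0} | Suc i \<Rightarrow> block_set (Suc i)) = 0"
    by (intro hausdorff_content_UN_eq_0) (simp split: nat.split)
  moreover have "block_union \<subseteq> (\<Union>i. case i of 0 \<Rightarrow> {0} | Suc i \<Rightarrow> block_set (Suc i))"
  proof
    fix x assume "x \<in> block_union"
    then consider "x = 0" | i where "i \<ge> 1" "x \<in> block_set i" by (auto simp: block_union_def)
    then show "x \<in> (\<Union>i. case i of 0 \<Rightarrow> {0} | Suc i \<Rightarrow> block_set (Suc i))"
    proof cases
      case 1
      then show ?thesis by (intro UN_I[of 0]) auto
    next
      case 2
      then show ?thesis by (intro UN_I[of i]) (auto split: nat.split)
    qed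
  qed
  ultimately show ?thesis using hausdorff_content_mono by (metis le_zero_eq)
qed

lemma block_union_content_neq_0:
  fixes t :: real
  assumes D: "D \<in> admissible_diameters" and t: "t \<ge> 0" and \<rho>: "\<rho> > 0" and j: "j \<ge> 1"
    and dense: "\<And>r. r \<in> D \<Longrightarrow> r < \<rho> \<Longrightarrow> \<exists>n. (1/2) ^ n \<le> r \<and> r \<le> 2 * (1/2) ^ n \<and>
      t * n \<le> card (factorial_blocks j \<inter> {1..n})"
  shows "hausdorff_content D t block_union \<noteq> 0"
proof -
  have "hausdorff_content D t (block_set j) \<noteq> 0"
    unfolding block_set_def
  proof (rule hausdorff_content_digit_set_neq_0[OF factorial_blocks_subset _ t \<rho>])
    show "D \<subseteq> {0<..}" using D by (simp add: admissible_diameters_def)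
    fix r assume "r \<in> D" "r < \<rho>"
    from dense[OF this] obtain n where n: "(1/2) ^ n \<le> r" "r \<le> 2 * (1/2) ^ n"
      "t * n \<le> card (factorial_blocks j \<inter> {1..n})" by blast
    have "(1/2 :: real) ^ card (factorial_blocks j \<inter> {1..n})
        = (1/2) powr card (factorial_blocks j \<inter> {1..n})"
      by (simp add: powr_realpow)
    also have "\<dots> \<le> (1/2) powr (t * n)" using n(3) by (intro powr_mono') auto
    also have "\<dots> = ((1/2) ^ n) powr t"
      by (simp add: powr_realpow[symmetric] powr_powr mult.commute)
    also have "\<dots> \<le> r powr t" using n(1) t by (intro powr_mono2) auto
    finally show "\<exists>n. r \<le> 2 * (1/2) ^ n \<and>
        (1/2) ^ card (factorial_blocks j \<inter> {1..n}) \<le> r powr t" using n(2) by blast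
  qed simp
  moreover have "hausdorff_content D t (block_set j) \<le> hausdorff_content D t block_union"
    using j by (intro hausdorff_content_mono) (auto simp: block_union_def)
  ultimately show ?thesis by auto
qed

text \<open>Positive content for some \<open>s > 0\<close> must come from one piece \<open>i\<close>, and then \<open>S\<^sub>i\<close> has density
  at least \<open>s / 4\<close> at all small scales taken from \<open>D\<close>.  Amplification yields a piece \<open>j\<close> with density at
  least \<open>t\<close> at the same scales, hence with positive content for \<open>t\<close>.\<close>

lemma block_union_content_below_1:
  assumes D: "D \<in> admissible_diameters" and s: "s > 0" "hausdorff_content D s block_union \<noteq> 0"
    and t: "0 \<le> t" "t < 1"
  shows "hausdorff_content D t block_union \<noteq> 0"
proof -
  obtain i e where i: "i \<ge> 1" and e: "e > 0" and
    big: "\<And>r n. r \<in> D \<Longrightarrow> (1/2) ^ n \<le> r \<Longrightarrow> e \<le> 2 ^ card (factorial_blocks i \<inter> {1..n}) * r powr s"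
    using block_union_content_eq_0[OF D s(1)] s(2) by (meson not_less)
  (* For r < e powr (2 / s) the constant e is absorbed by half of the exponent s; r < 1/2 forces
     n \<ge> 2, so that n - 1 \<ge> n / 2 costs another factor 2. *)
  define \<rho> where "\<rho> = min (1/2) (e powr (2 / s))"
  (* The first bound lets the S_j-blocks reach as far as n does, the second gives 1 - i/j \<ge> t. *)
  obtain j :: nat where j: "max (i / (s / 4)) (i / (1 - t)) < j" using reals_Archimedean2 by blast
  have "0 \<le> i / (s / 4)" using s(1) by simp
  then have j1: "j \<ge> 1" using j by linarith
  show ?thesis
  proof (rule block_union_content_neq_0[OF D t(1) _ j1])
    show "\<rho> > 0" using e by (simp add: \<rho>_def)
    fix r assume r: "r \<in> D" "r < \<rho>"
    have r0: "r > 0" using r(1) D by (auto simp: admissible_diameters_def)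
    obtain n where n: "n \<ge> 1" "(1/2) ^ n \<le> r" "r < 2 * (1/2) ^ n"
      using obtain_dyadic_scale[of r] r0 r(2) by (auto simp: \<rho>_def)
    have "n \<noteq> 1" using n(2) r(2) by (auto simp: \<rho>_def)
    then have n2: "real n \<ge> 2" using n(1) by linarith
    let ?c = "card (factorial_blocks i \<inter> {1..n})"
    have "r powr (s / 2) \<le> (e powr (2 / s)) powr (s / 2)"
      using r(2) r0 s(1) by (intro powr_mono2) (auto simp: \<rho>_def)
    also have "\<dots> = e" using e s(1) by (simp add: powr_powr)
    also have "e \<le> 2 ^ ?c * r powr s" by (rule big[OF r(1) n(2)])
    also have "r powr s = r powr (s / 2) * r powr (s / 2)" by (simp flip: powr_add)
    finally have "r powr (s / 2) * 1 \<le> r powr (s / 2) * (2 ^ ?c * r powr (s / 2))"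
      by (simp add: mult_ac)
    then have "1 \<le> 2 ^ ?c * r powr (s / 2)" using r0 by (subst (asm) mult_le_cancel_left_pos) auto
    also have "\<dots> \<le> 2 ^ ?c * (2 * (1/2) ^ n) powr (s / 2)"
      using n(3) r0 s(1) by (intro mult_left_mono powr_mono2) auto
    also have "2 * (1/2 :: real) ^ n = 2 powr (1 - real n)"
      unfolding half_power_eq_powr by (simp add: powr_diff powr_minus divide_inverse)
    also have "2 ^ ?c * (2 powr (1 - real n)) powr (s / 2) = 2 powr (?c + (1 - real n) * (s / 2))"
      by (simp add: powr_powr powr_add powr_realpow)
    finally have "0 \<le> ?c + (1 - real n) * (s / 2)"
      by (subst powr_le_cancel_iff[of 2, symmetric]) simp_all
    then have "(real n - 1) * (s / 2) \<le> ?c" by (simp add: field_simps)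
    moreover have "s / 4 * n \<le> (real n - 1) * (s / 2)"
    proof -
      have "s * n \<le> s * (2 * (real n - 1))" using n2 s(1) by (intro mult_left_mono) auto
      then show ?thesis by (simp add: field_simps)
    qed
    ultimately have "s / 4 * n \<le> ?c" by linarith
    from card_factorial_blocks_amplify[OF n(1) _ this j1] s(1) j
    have "(1 - i / j) * n \<le> card (factorial_blocks j \<inter> {1..n})" by simp
    moreover have "t * n \<le> (1 - i / j) * n"
      using j t(2) j1 by (intro mult_right_mono) (simp_all add: field_simps)
    ultimately have "t * n \<le> card (factorial_blocks j \<inter> {1..n})"
      by (rule order_trans[rotated])
    then show "\<exists>n. (1/2) ^ n \<le> r \<and> r \<le> 2 * (1/2) ^ n \<and>
        t * n \<le> card (factorial_blocks j \<inter> {1..n})"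
      using n by (intro exI[of _ n]) auto
  qed
qed

lemma block_union_content_above_1:
  assumes D: "D \<in> admissible_diameters" and s: "s > 1"
  shows "hausdorff_content D s block_union = 0"
proof (rule block_union_content_eq_0[OF D])
  fix i :: nat and e :: real assume e: "e > 0"
  then have "min 1 ((e / 2) powr (1 / (s - 1))) > 0" by simp
  with D obtain r where r: "r \<in> D" "0 < r" "r < min 1 ((e / 2) powr (1 / (s - 1)))"
    by (rule admissible_diameters_small)
  obtain n where n: "(1/2) ^ n \<le> r" "r < 2 * (1/2) ^ n" using obtain_dyadic_scale[of r] r by auto
  have "card (factorial_blocks i \<inter> {1..n}) \<le> n" by (rule card_le_if_bounded) simp
  then have "2 ^ card (factorial_blocks i \<inter> {1..n}) * r powr s \<le> 2 ^ n * r powr s"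
    by (intro mult_right_mono power_increasing) auto
  also have "\<dots> = 2 ^ n * r * r powr (s - 1)" using r(2) by (simp add: powr_diff)
  also have "\<dots> \<le> 2 * r powr (s - 1)"
    using n(2) by (intro mult_right_mono) (simp_all add: field_simps power_one_over)
  also have "\<dots> < 2 * ((e / 2) powr (1 / (s - 1))) powr (s - 1)"
    using r s by (intro mult_strict_left_mono powr_less_mono2) auto
  also have "\<dots> = e" using e s by (simp add: powr_powr)
  finally show "\<exists>r\<in>D. \<exists>n. (1/2) ^ n \<le> r \<and> 2 ^ card (factorial_blocks i \<inter> {1..n}) * r powr s < e"
    using r(1) n(1) by blast
qed (use s in simp)

lemma hausdorff_dim_block_union_eq_0:
  assumes "\<And>s. s > 0 \<Longrightarrow> hausdorff_content D s block_union = 0"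
  shows "hausdorff_dim D block_union = 0"
proof -
  have "hausdorff_dim D block_union \<le> 0 + ennreal s" if "s > 0" for s
    unfolding hausdorff_dim_def using assms[OF that] that by (auto intro!: Inf_lower)
  then have "hausdorff_dim D block_union \<le> 0" by (rule ennreal_le_epsilon)
  then show ?thesis by simp
qed

lemma hausdorff_dim_block_union_eq_1:
  assumes D: "D \<in> admissible_diameters" and s: "s > 0" "hausdorff_content D s block_union \<noteq> 0"
  shows "hausdorff_dim D block_union = 1"
proof (rule antisym)
  have "hausdorff_dim D block_union \<le> 1 + ennreal e" if "e > 0" for e
  proof -
    have "hausdorff_dim D block_union \<le> ennreal (1 + e)"
      unfolding hausdorff_dim_def using block_union_content_above_1[OF D, of "1 + e"] that
      by (intro Inf_lower CollectI exI[of _ "1 + e"]) auto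
    then show ?thesis using that by simp
  qed
  then show "hausdorff_dim D block_union \<le> 1" by (rule ennreal_le_epsilon)
next
  have "1 \<le> t" if "0 \<le> t" "hausdorff_content D t block_union = 0" for t
    using block_union_content_below_1[OF D s that(1)] that(2) by (meson not_le)
  then show "1 \<le> hausdorff_dim D block_union"
    unfolding hausdorff_dim_def by (intro Inf_greatest) auto
qed

lemma factorial_scales_admissible:
  "dyadic_scales (range (\<lambda>k. fact (2 * k + c))) \<in> admissible_diameters"
proof (rule dyadic_scales_admissible)
  have "k \<le> fact (2 * k + c)" for k :: nat
    using fact_ge_self[of "2 * k + c"] by linarith
  then show "infinite (range (\<lambda>k. fact (2 * k + c) :: nat))"
    unfolding infinite_nat_iff_unbounded_le by blast
qed

lemma hausdorff_dim_odd_factorials: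
  "hausdorff_dim (dyadic_scales (range (\<lambda>k. fact (2 * k + 1)))) block_union = 0"
proof (intro hausdorff_dim_block_union_eq_0 block_union_content_eq_0 factorial_scales_admissible)
  fix s e :: real and i :: nat assume s: "s > 0" and e: "e > 0"
  obtain m where m: "(1/2 :: real) ^ m < e" using real_arch_pow_inv[OF e, of "1/2"] by auto
  (* With s (2k+1) \<ge> i + 1, the lengths of 2^(i (2k)!) intervals of length
     (1/2)^((2k+1)!) have s-th powers with sum at most (1/2)^((2k)!). *)
  obtain l :: nat where l: "(i + 1) / s < l" using reals_Archimedean2 by blast
  define k where "k = max (max m i) l"
  let ?f = "fact (2 * k) :: nat" and ?n = "fact (2 * k + 1) :: nat"
  have n: "?n = (2 * k + 1) * ?f" by simp
  have "card (factorial_blocks i \<inter> {1..?n}) \<le> i * ?f"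
    by (rule card_factorial_blocks_between) (simp add: k_def)
  then have "(2 :: real) ^ card (factorial_blocks i \<inter> {1..?n}) * ((1/2) ^ ?n) powr s
      \<le> 2 ^ (i * ?f) * ((1/2) ^ ?n) powr s"
    by (intro mult_right_mono power_increasing) auto
  also have "\<dots> = 2 powr (i * ?f - ?n * s)"
    unfolding half_power_eq_powr by (simp only: powr_powr powr_realpow[symmetric] zero_less_numeral flip: powr_add)
      (simp only: mult_minus_left diff_conv_add_uminus)
  also have "\<dots> \<le> 2 powr (- real ?f)"
  proof (rule powr_mono)
    have "real (i + 1) \<le> s * l" using l s by (simp add: field_simps)
    also have "\<dots> \<le> s * (2 * k + 1)" using s by (intro mult_left_mono) (auto simp: k_def)
    finally have "real (i + 1) * ?f \<le> s * (2 * k + 1) * ?f" by (rule mult_right_mono) simp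
    then show "real (i * ?f) - ?n * s \<le> - real ?f" unfolding n by (simp add: algebra_simps)
  qed simp
  also have "\<dots> = (1/2) ^ ?f" by (rule half_power_eq_powr[symmetric])
  also have "\<dots> \<le> (1/2) ^ m"
  proof (rule power_decreasing)
    show "m \<le> ?f" using fact_ge_self[of "2 * k"] by (simp add: k_def)
  qed auto
  finally have "(2 :: real) ^ card (factorial_blocks i \<inter> {1..?n}) * ((1/2) ^ ?n) powr s < e"
    using m by simp
  moreover have "(1/2 :: real) ^ ?n \<in> dyadic_scales (range (\<lambda>k. fact (2 * k + 1)))"
    unfolding dyadic_scales_def by (intro UN_I[of ?n]) auto
  ultimately show "\<exists>r\<in>dyadic_scales (range (\<lambda>k. fact (2 * k + 1))). \<exists>n. (1/2) ^ n \<le> r \<and>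
      2 ^ card (factorial_blocks i \<inter> {1..n}) * r powr s < e" by blast
qed

lemma hausdorff_dim_even_factorials:
  "hausdorff_dim (dyadic_scales (range (\<lambda>k. fact (2 * k)))) block_union = 1"
  (is "hausdorff_dim ?D _ = 1")
proof -
  have D: "?D \<in> admissible_diameters" using factorial_scales_admissible[of 0] by simp
  have "hausdorff_content ?D (1/2) block_union \<noteq> 0"
  proof (rule block_union_content_neq_0[OF D, where \<rho> = 1 and j = 2])
    fix r assume "r \<in> ?D"
    then obtain k where r: "r \<in> {(1/2) ^ fact (2 * k)..<2 * (1/2) ^ fact (2 * k)}"
      by (auto simp: dyadic_scales_def)
    have "1/2 * real (fact (2 * k)) \<le> card (factorial_blocks 2 \<inter> {1..fact (2 * k)})"
      using card_factorial_blocks_ge[of "fact (2 * k)" 2 k] by simp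
    then show "\<exists>n. (1/2) ^ n \<le> r \<and> r \<le> 2 * (1/2) ^ n \<and>
        1/2 * real n \<le> card (factorial_blocks 2 \<inter> {1..n})"
      using r by (intro exI[of _ "fact (2 * k)"]) auto
  qed auto
  then show ?thesis
    by (intro hausdorff_dim_block_union_eq_1[OF D]) auto
qed

theorem proposition3p9:
  "\<exists>(S :: nat \<Rightarrow> nat set) (K :: real set).
     (\<forall>i\<ge>1. S i \<subseteq> {1..}) \<and>
     K = {0} \<union> (\<Union>i\<in>{1..}. (\<lambda>a. (1/2) ^ i * (1 + a)) ` binary_digit_set (S i)) \<and>
     compact K \<and>
     {hausdorff_dim D K |D. D \<in> admissible_diameters} = {0, 1}"
proof (intro exI conjI)
  show "\<forall>i\<ge>1. factorial_blocks i \<subseteq> {1..}" using factorial_blocks_subset by blast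
  show "block_union = {0} \<union>
      (\<Union>i\<in>{1..}. (\<lambda>a. (1/2) ^ i * (1 + a)) ` binary_digit_set (factorial_blocks i))"
    by (simp add: block_union_def block_set_def)
  show "compact block_union" by (rule compact_block_union)
  show "{hausdorff_dim D block_union |D. D \<in> admissible_diameters} = {0, 1}"
  proof (rule equalityI)
    have "hausdorff_dim D block_union \<in> {0, 1}" if "D \<in> admissible_diameters" for D
      using hausdorff_dim_block_union_eq_0 hausdorff_dim_block_union_eq_1[OF that] by blast
    then show "{hausdorff_dim D block_union |D. D \<in> admissible_diameters} \<subseteq> {0, 1}"
      by fast
    have "0 \<in> {hausdorff_dim D block_union |D. D \<in> admissible_diameters}"
      by (intro CollectI exI conjI, rule hausdorff_dim_odd_factorials[symmetric])
        (rule factorial_scales_admissible)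
    moreover have "1 \<in> {hausdorff_dim D block_union |D. D \<in> admissible_diameters}"
      by (intro CollectI exI conjI, rule hausdorff_dim_even_factorials[symmetric])
        (use factorial_scales_admissible[of 0] in simp)
    ultimately show "{0, 1} \<subseteq> {hausdorff_dim D block_union |D. D \<in> admissible_diameters}"
      by (simp only: insert_subset empty_subsetI)
  qed
qed

end
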